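(* Suppose that $(f,\mathcal{X},\mu)$ is an ergodic measure preserving system satisfying assumption (A5) (see context). Consider the observable $\phi(x)=\psi(\mathrm{dist}(x,\tilde{x}))$, where $\tilde{x}\in\mathcal{X}$ and $\psi(y)\to\infty$ as $y\to0$. Suppose that the balls $B(\tilde{x},r_n)$ are such that $\mu(B(\tilde{x},r_n))\le c/n$, for some $c>0$. For the sequence $u_n=\psi(r_n)$, we have $$\mu(M_n\le u_n\text{ i.o.})=1,$$ that is, $$\mu(\mathcal{H}_{\mathrm{ea}})=\mu(M_n>u_n\text{ ev.})=0 .$$
   Context: $(\mathcal{X},\mathcal{B},\mu)$ is a probability space with a metric $\mathrm{dist}$ for which open sets are measurable, and $f\colon\mathcal{X}\to\mathcal{X}$ is measurable and preserves $\mu$. $B(x,r)=B_r(x)$ is the ball of radius $r$ centred at $x$. The function $\psi\colon[0,\infty)\to\mathbb{R}\cup\{\pm\infty\}$ is decreasing and continuous. Put $X_i=\phi\circ f^{i-1}$ for $i\ge1$ and $M_n=\max(X_1,\dots,X_n)$. $(E_n\text{ i.o.})$ is the set of points belonging to $E_n$ for infinitely many $n$, and $(E_n\text{ ev.})$ is the set of points belonging to $E_n$ for all sufficiently large $n$. With $B_m=B(\tilde{x},r_m)$, the eventually always hitting set is $\mathcal{H}_{\mathrm{ea}}=\bigcup_{n\ge1}\bigcap_{m\ge n}\bigcup_{k=0}^{m-1}f^{-k}(B_m)$. Assumption (A5): given constants $\sigma_1,\sigma_2>1$, there is a set $\mathcal{M}_r\subset\mathcal{X}$ (depending on the radius $r$)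 with $\mu(\mathcal{M}_r)\le C_1|\log r|^{-\sigma_1}$, such that for all $\tilde{x}\notin\mathcal{M}_r$ $$\Bigl|\mu\Bigl(x:\sum_{k=0}^{t/\mu(B_r(\tilde{x}))}\mathbb{1}_{B_r(\tilde{x})}(f^k(x))=0\Bigr)-e^{-\theta t}\Bigr|\le C_2|\log r|^{-\sigma_2}$$ for all $t\ge0$, where $C_1,C_2$ are constants and $\theta\in[0,1]$ is the extremal index.
   Formalization: The result is stated for μ-almost every centre x̃ (with all r_n ≥ 0 and c at once) rather than for every x̃ ∈ X: (A5) says nothing about centres lying in M_r for all small r, and at such a point the claim can fail. *)

theory Defs
  imports "HOL-Probability.Probability"
begin

definition measure_preserving :: "'a measure \<Rightarrow> ('a \<Rightarrow> 'a) \<Rightarrow> bool" where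
  "measure_preserving \<mu> f \<longleftrightarrow>
     f \<in> measurable \<mu> \<mu> \<and>
     (\<forall>A\<in>sets \<mu>. emeasure \<mu> (f -` A \<inter> space \<mu>) = emeasure \<mu> A)"

definition ergodic :: "'a measure \<Rightarrow> ('a \<Rightarrow> 'a) \<Rightarrow> bool" where
  "ergodic \<mu> f \<longleftrightarrow>
     measure_preserving \<mu> f \<and>
     (\<forall>A\<in>sets \<mu>. f -` A \<inter> space \<mu> = A \<longrightarrow> measure \<mu> A = 0 \<or> measure \<mu> A = 1)"

text \<open>
  The condition is a small-radius one: it is imposed for all sufficiently small \<open>r > 0\<close>
  (equivalently, after enlarging \<open>C1\<close> and putting \<open>Mr r = UNIV\<close> for the remaining radii, for all
  \<open>0 < r < 1\<close>).  The quotient \<open>t / \<mu>(B)\<close> only makes sense for balls of positive measure, so the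
  positivity is spelled out; otherwise the convention \<open>t / 0 = 0\<close> would give the condition an
  unintended meaning.  The sum runs up to the integer part of \<open>t / \<mu>(B)\<close>.  The extremal index
  may depend on the centre \<open>z\<close>, a constant index being the special case of a constant function;
  \<open>C1\<close> and \<open>C2\<close> depend neither on the radius nor on the centre.
\<close>

definition assumption_A5 ::
  "'a::metric_space measure \<Rightarrow> ('a \<Rightarrow> 'a) \<Rightarrow> real \<Rightarrow> real \<Rightarrow> bool" where
  "assumption_A5 \<mu> f \<sigma>1 \<sigma>2 \<longleftrightarrow>
     (\<exists>(Mr :: real \<Rightarrow> 'a set) (\<theta> :: 'a \<Rightarrow> real) (C1 :: real) (C2 :: real).
        (\<forall>z. 0 \<le> \<theta> z \<and> \<theta> z \<le> 1) \<and>
        (\<forall>\<^sub>F r in at_right 0.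
           Mr r \<in> sets \<mu> \<and>
           measure \<mu> (Mr r) \<le> C1 * \<bar>ln r\<bar> powr (- \<sigma>1) \<and>
           (\<forall>z. z \<notin> Mr r \<longrightarrow>
              0 < measure \<mu> (ball z r) \<and>
              (\<forall>t\<ge>0.
                 \<bar>measure \<mu> {x \<in> space \<mu>.
                     (\<Sum>k = 0..nat \<lfloor>t / measure \<mu> (ball z r)\<rfloor>.
                        (indicator (ball z r) ((f ^^ k) x) :: real)) = 0}
                  - exp (- \<theta> z * t)\<bar> \<le> C2 * \<bar>ln r\<bar> powr (- \<sigma>2)))))"

definition observable :: "(real \<Rightarrow> ereal) \<Rightarrow> 'a::metric_space \<Rightarrow> 'a \<Rightarrow> ereal" where
  "observable \<psi> z x = \<psi> (dist x z)"

definition process :: "('a \<Rightarrow> 'a) \<Rightarrow> ('a \<Rightarrow> ereal) \<Rightarrow> nat \<Rightarrow> 'a \<Rightarrow> ereal" where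
  "process f \<phi> i = \<phi> \<circ> (f ^^ (i - 1))"

text \<open>Only used for \<open>n \<ge> 1\<close>.\<close>

definition running_max :: "('a \<Rightarrow> 'a) \<Rightarrow> ('a \<Rightarrow> ereal) \<Rightarrow> nat \<Rightarrow> 'a \<Rightarrow> ereal" where
  "running_max f \<phi> n x = Max ((\<lambda>i. process f \<phi> i x) ` {1..n})"

definition eventually_always_hitting ::
  "('a::metric_space \<Rightarrow> 'a) \<Rightarrow> 'a \<Rightarrow> (nat \<Rightarrow> real) \<Rightarrow> 'a set" where
  "eventually_always_hitting f z r =
     (\<Union>n\<in>{1..}. \<Inter>m\<in>{n..}. \<Union>k\<in>{0..m - 1}. (f ^^ k) -` ball z (r m))"

end

theory Submission
  imports Defs "HOL-Real_Asymp.Real_Asymp"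
begin

text \<open>
  By Borel--Cantelli, almost every centre \<open>z\<close> avoids the exceptional sets of the radii
  \<open>exp (- k)\<close> for all large \<open>k\<close>.  Write \<open>b k\<close> for the measure of \<open>ball z (exp (- k))\<close> and choose
  the time \<open>n = \<lfloor>c / b k\<rfloor> + 1\<close>: then \<open>c / n < b k\<close> forces \<open>r n < exp (- k)\<close>, and \<open>n\<close> steps of the
  orbit fit into the time window with \<open>t = c + 1\<close>.  So the orbit misses \<open>ball z (r n)\<close> up to time
  \<open>n\<close> with probability bounded below, for infinitely many \<open>n\<close>.  Hence the eventually always hitting set does not have full
  measure.  As the radii tend to 0, that set is forward invariant up to the null set \<open>{z}\<close>, and
  ergodicity makes it null.  If \<open>z\<close> is an atom, the balls are eventually empty.
\<close>

section \<open>Sets of points lying eventually in a sequence of sets\<close>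

lemma (in prob_space) sets_eventually_mem:
  assumes "space M = UNIV" "\<And>n. C n \<in> sets M"
  shows "{x. \<forall>\<^sub>F n in sequentially. x \<in> C n} \<in> sets M"
proof -
  have "{x. \<forall>\<^sub>F n in sequentially. x \<in> C n} = (\<Union>N. \<Inter>n\<in>{N..}. C n)"
    by (auto simp: eventually_sequentially)
  also have "\<dots> \<in> sets M"
    using assms by (intro sets.countable_UN sets.countable_INT') auto
  finally show ?thesis .
qed

text \<open>The set is the increasing union of the tail intersections. Each of these lies in some
  \<open>C n\<close> of measure at most \<open>b\<close>, and continuity from below passes the bound
  to the union.\<close>

lemma (in prob_space) measure_eventually_mem_le:
  assumes "space M = UNIV" "\<And>n. C n \<in> sets M"
    and freq: "\<exists>\<^sub>F n in sequentially. prob (C n) \<le> b"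
  shows "prob {x. \<forall>\<^sub>F n in sequentially. x \<in> C n} \<le> b"
proof -
  let ?L = "\<lambda>N. \<Inter>n\<in>{N..}. C n"
  have eq: "{x. \<forall>\<^sub>F n in sequentially. x \<in> C n} = (\<Union>N. ?L N)"
    by (auto simp: eventually_sequentially)
  have L: "?L N \<in> sets M" for N
    using assms by (intro sets.countable_INT') auto
  have "prob (?L N) \<le> b" for N
  proof -
    obtain n where "n \<ge> N" "prob (C n) \<le> b"
      using freq by (auto simp: frequently_sequentially)
    moreover have "prob (?L N) \<le> prob (C n)"
      using assms \<open>n \<ge> N\<close> by (intro finite_measure_mono) auto
    ultimately show ?thesis by simp
  qed
  moreover have "(\<lambda>N. prob (?L N)) \<longlonglongrightarrow> prob (\<Union>N. ?L N)"
    using L by (intro finite_Lim_measure_incseq) (auto simp: incseq_def)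
  ultimately show ?thesis
    unfolding eq by (intro LIMSEQ_le_const2) auto
qed

section \<open>Measure preserving and ergodic maps\<close>

lemma measurable_funpow:
  assumes "f \<in> measurable M M"
  shows "(f ^^ n) \<in> measurable M M"
proof (induction n)
  case 0
  then show ?case by (simp add: id_def)
next
  case (Suc n)
  then show ?case using assms by (simp add: measurable_comp)
qed

lemma vimage_funpow_sets:
  assumes "measure_preserving \<mu> f" "space \<mu> = UNIV" "A \<in> sets \<mu>"
  shows "(f ^^ n) -` A \<in> sets \<mu>"
  using measurable_sets[OF measurable_funpow[of f \<mu> n] assms(3)] assms
  by (simp add: measure_preserving_def)

lemma measure_vimage_funpow:
  assumes mp: "measure_preserving \<mu> f" and sp: "space \<mu> = UNIV" and A: "A \<in> sets \<mu>"
  shows "measure \<mu> ((f ^^ n) -` A) = measure \<mu> A"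
proof (induction n)
  case 0
  then show ?case by simp
next
  case (Suc n)
  have "(f ^^ Suc n) -` A = f -` ((f ^^ n) -` A)"
    by (auto simp: funpow_swap1)
  moreover have "emeasure \<mu> (f -` ((f ^^ n) -` A)) = emeasure \<mu> ((f ^^ n) -` A)"
    using mp vimage_funpow_sets[OF mp sp A, of n] sp by (auto simp: measure_preserving_def)
  ultimately show ?case using Suc by (simp only: measure_def)
qed

text \<open>The points whose orbit eventually stays in \<open>H\<close> form an exactly invariant
  set of measure at most that of \<open>H\<close>, hence null by ergodicity. Every other point of
  \<open>H\<close> has an orbit that leaves \<open>H\<close>, so it lies in a preimage of the null
  exit set.\<close>

lemma ergodic_forward_invariant_null:
  assumes "prob_space \<mu>" and sp: "space \<mu> = UNIV" and erg: "ergodic \<mu> f"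
    and H: "H \<in> sets \<mu>" and less: "measure \<mu> H < 1"
    and inv: "measure \<mu> (H - f -` H) = 0"
  shows "measure \<mu> H = 0"
proof -
  interpret prob_space \<mu> by fact
  have mp: "measure_preserving \<mu> f" using erg by (simp add: ergodic_def)
  note vs = vimage_funpow_sets[OF mp sp]
  define L where "L = {x. \<forall>\<^sub>F n in sequentially. x \<in> (f ^^ n) -` H}"
  have L: "L \<in> sets \<mu>"
    unfolding L_def by (intro sets_eventually_mem sp vs H)
  have "measure \<mu> L \<le> measure \<mu> H"
    unfolding L_def
    by (intro measure_eventually_mem_le sp vs H) (simp add: measure_vimage_funpow[OF mp sp H])
  \<comment> \<open>A shift of time by one does not change what happens eventually.\<close>
  moreover have "f -` L = L"
    using eventually_sequentially_Suc[of "\<lambda>n. (f ^^ n) x \<in> H" for x]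
    by (auto simp: L_def funpow_swap1)
  ultimately have L0: "measure \<mu> L = 0"
    using erg L less sp by (auto simp: ergodic_def)
  define N where "N = H - f -` H"
  have N: "N \<in> sets \<mu>" unfolding N_def using vs[OF H, of 1] H by auto
  have "(f ^^ n) -` N \<in> null_sets \<mu>" for n
    using vs[OF N] measure_vimage_funpow[OF mp sp N, of n] inv
    by (simp add: null_sets_def emeasure_eq_measure N_def)
  then have U: "(\<Union>n. (f ^^ n) -` N) \<in> null_sets \<mu>" by blast
  have "H \<subseteq> L \<union> (\<Union>n. (f ^^ n) -` N)"
  proof
    fix x assume x: "x \<in> H"
    show "x \<in> L \<union> (\<Union>n. (f ^^ n) -` N)"
    proof (cases "\<exists>n. (f ^^ n) x \<in> N")
      case False
      \<comment> \<open>Any step out of \<open>H\<close> would start from a point of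
        \<open>N\<close>.\<close>
      have "(f ^^ n) x \<in> H" for n
        by (induction n) (use x False in \<open>auto simp: N_def\<close>)
      then show ?thesis by (simp add: L_def)
    qed auto
  qed
  moreover have "L \<union> (\<Union>n. (f ^^ n) -` N) \<in> null_sets \<mu>"
    using L L0 U by (intro null_sets.Un) (auto simp: null_sets_def emeasure_eq_measure)
  ultimately have "H \<in> null_sets \<mu>" using H null_sets_subset by blast
  then show ?thesis by (simp add: measure_eq_0_null_sets)
qed

section \<open>Hitting times along exponentially small radii\<close>

text \<open>The event of (A5), with the vanishing sum of indicators unfolded into avoidance at each
  time of the window.\<close>

definition late_hit :: "'a::metric_space measure \<Rightarrow> ('a \<Rightarrow> 'a) \<Rightarrow> 'a \<Rightarrow> real \<Rightarrow> real \<Rightarrow> 'a set" where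
  "late_hit \<mu> f z \<rho> t =
     {x. \<forall>j \<le> nat \<lfloor>t / measure \<mu> (ball z \<rho>)\<rfloor>. (f ^^ j) x \<notin> ball z \<rho>}"

text \<open>Since \<open>\<sigma>1 > 1\<close>, the exceptional sets along the radii
  \<open>exp (- k)\<close> have summable measures. They do not involve \<open>t\<close>, so one null
  set of centres serves all \<open>t\<close>.\<close>

lemma A5_AE_late_hit:
  assumes "prob_space \<mu>" and sp: "space \<mu> = UNIV" and "\<sigma>1 > 1" "\<sigma>2 > 1"
    and A5: "assumption_A5 \<mu> f \<sigma>1 \<sigma>2"
  shows "AE z in \<mu>. \<forall>t\<ge>0. \<forall>\<^sub>F k in sequentially.
           0 < measure \<mu> (ball z (exp (- real k))) \<and>
           exp (- t) / 2 \<le> measure \<mu> (late_hit \<mu> f z (exp (- real k)) t)"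
proof -
  interpret prob_space \<mu> by fact
  obtain Mr \<theta> C1 C2 where th: "\<And>z. 0 \<le> \<theta> z \<and> \<theta> z \<le> 1"
    and ev: "\<forall>\<^sub>F r in at_right 0.
           Mr r \<in> sets \<mu> \<and>
           measure \<mu> (Mr r) \<le> C1 * \<bar>ln r\<bar> powr (- \<sigma>1) \<and>
           (\<forall>z. z \<notin> Mr r \<longrightarrow>
              0 < measure \<mu> (ball z r) \<and>
              (\<forall>t\<ge>0.
                 \<bar>measure \<mu> {x \<in> space \<mu>.
                     (\<Sum>k = 0..nat \<lfloor>t / measure \<mu> (ball z r)\<rfloor>.
                        (indicator (ball z r) ((f ^^ k) x) :: real)) = 0}
                  - exp (- \<theta> z * t)\<bar> \<le> C2 * \<bar>ln r\<bar> powr (- \<sigma>2)))"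
    using A5 unfolding assumption_A5_def by blast
  have late: "{x \<in> space \<mu>. (\<Sum>k = 0..nat \<lfloor>t / measure \<mu> (ball z r)\<rfloor>.
                (indicator (ball z r) ((f ^^ k) x) :: real)) = 0} = late_hit \<mu> f z r t" for t z r
    unfolding late_hit_def sp
    by (subst sum_nonneg_eq_0_iff) (auto simp: indicator_def)
  \<comment> \<open>At these radii \<open>\<bar>ln r\<bar> = k\<close>, which turns the logarithmic
    bounds into powers of \<open>k\<close>.\<close>
  have "filterlim (\<lambda>k. exp (- real k)) (at_right 0) sequentially"
    by real_asymp
  note evk = eventually_compose_filterlim[OF ev this, unfolded late]
  then obtain K where K: "\<And>k. k \<ge> K \<Longrightarrow>
      Mr (exp (- real k)) \<in> sets \<mu> \<and>
      measure \<mu> (Mr (exp (- real k))) \<le> C1 * real k powr (- \<sigma>1) \<and>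
      (\<forall>z. z \<notin> Mr (exp (- real k)) \<longrightarrow> 0 < measure \<mu> (ball z (exp (- real k))) \<and>
         (\<forall>t\<ge>0. \<bar>measure \<mu> (late_hit \<mu> f z (exp (- real k)) t) - exp (- \<theta> z * t)\<bar>
                   \<le> C2 * real k powr (- \<sigma>2)))"
    unfolding eventually_sequentially by auto
  \<comment> \<open>The shift by \<open>K\<close> makes measurability and the bound hold for every
    index, as the Borel-Cantelli lemma requires.\<close>
  define A where "A k = Mr (exp (- real (k + K)))" for k
  have "summable (\<lambda>k. C1 * real k powr (- \<sigma>1))"
    using \<open>\<sigma>1 > 1\<close> by (intro summable_mult) (simp add: summable_real_powr_iff)
  then have "summable (\<lambda>k. C1 * real (k + K) powr (- \<sigma>1))"
    by (subst summable_iff_shift[of "\<lambda>k. C1 * real k powr (- \<sigma>1)"])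
  then have "summable (\<lambda>k. measure \<mu> (A k))"
    by (rule summable_comparison_test'[where N = 0]) (use K in \<open>auto simp: A_def simp del: of_nat_add\<close>)
  then have "AE z in \<mu>. \<forall>\<^sub>F k in sequentially. z \<in> space \<mu> - A k"
    by (intro borel_cantelli_AE1) (use K in \<open>auto simp: A_def emeasure_eq_measure simp del: of_nat_add\<close>)
  then show ?thesis
  proof (rule AE_mp, intro AE_I2 impI allI)
    fix z and t :: real
    assume "\<forall>\<^sub>F k in sequentially. z \<in> space \<mu> - A k" and t: "t \<ge> 0"
    then have "\<forall>\<^sub>F k in sequentially. z \<notin> Mr (exp (- real k))"
      using eventually_sequentially_seg[of "\<lambda>k. z \<notin> Mr (exp (- real k))" K]
      by (simp add: A_def sp)
    moreover have "(\<lambda>k. C2 * real k powr (- \<sigma>2)) \<longlonglongrightarrow> 0"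
      using \<open>\<sigma>2 > 1\<close> by real_asymp
    then have "\<forall>\<^sub>F k in sequentially. C2 * real k powr (- \<sigma>2) < exp (- t) / 2"
      by (rule order_tendstoD) simp
    ultimately show "\<forall>\<^sub>F k in sequentially. 0 < measure \<mu> (ball z (exp (- real k))) \<and>
           exp (- t) / 2 \<le> measure \<mu> (late_hit \<mu> f z (exp (- real k)) t)"
      using eventually_ge_at_top[of K]
    proof eventually_elim
      case (elim k)
      \<comment> \<open>\<open>\<theta> z \<le> 1\<close> gives a bound free of the extremal index;
        the error of (A5) then costs at most half of it.\<close>
      have "exp (- t) \<le> exp (- \<theta> z * t)"
        using th[of z] t by (simp add: mult_left_le_one_le)
      moreover have "\<bar>measure \<mu> (late_hit \<mu> f z (exp (- real k)) t) - exp (- \<theta> z * t)\<bar>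
                   \<le> C2 * real k powr (- \<sigma>2)"
        using K[OF elim(3)] elim(1) t by blast
      ultimately have "exp (- t) / 2 \<le> measure \<mu> (late_hit \<mu> f z (exp (- real k)) t)"
        using elim(2) by linarith
      then show ?case using K[OF elim(3)] elim(1) by blast
    qed
  qed
qed

section \<open>The eventually always hitting set\<close>

text \<open>One layer of the eventually always hitting set, isolated so that this set becomes a
  lower limit of measurable sets.\<close>

definition hit_by :: "('a::metric_space \<Rightarrow> 'a) \<Rightarrow> 'a \<Rightarrow> (nat \<Rightarrow> real) \<Rightarrow> nat \<Rightarrow> 'a set" where
  "hit_by f z r m = (\<Union>k\<in>{0..m - 1}. (f ^^ k) -` ball z (r m))"

lemma eventually_always_hitting_eq:
  "eventually_always_hitting f z r = {x. \<forall>\<^sub>F m in sequentially. x \<in> hit_by f z r m}"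
proof (intro equalityI subsetI)
  fix x assume "x \<in> {x. \<forall>\<^sub>F m in sequentially. x \<in> hit_by f z r m}"
  then obtain N where "\<And>m. m \<ge> N \<Longrightarrow> x \<in> hit_by f z r m"
    by (auto simp: eventually_sequentially)
  \<comment> \<open>The union in the definition starts at index 1, hence the witness
    \<open>max N 1\<close>.\<close>
  then show "x \<in> eventually_always_hitting f z r"
    unfolding eventually_always_hitting_def hit_by_def[symmetric]
    by (intro UN_I[of "max N 1"] INT_I) simp_all
qed (auto simp: eventually_always_hitting_def hit_by_def eventually_sequentially)

lemma hit_by_sets:
  assumes "measure_preserving \<mu> f" "space \<mu> = UNIV" "sets borel \<subseteq> sets \<mu>"
  shows "hit_by f z r m \<in> sets \<mu>"
  unfolding hit_by_def
  using assms by (intro sets.finite_UN vimage_funpow_sets) auto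

text \<open>Continuity from above: the balls shrink to their centre. The limit decides between the
  atomic and the non-atomic case below.\<close>

lemma ball_measure_tendsto:
  fixes \<mu> :: "'a::metric_space measure"
  assumes "prob_space \<mu>" "sets borel \<subseteq> sets \<mu>"
  shows "(\<lambda>k. measure \<mu> (ball z (exp (- real k)))) \<longlonglongrightarrow> measure \<mu> {z}"
proof -
  interpret prob_space \<mu> by fact
  have "(\<Inter>k. ball z (exp (- real k))) = {z}"
  proof (intro equalityI subsetI)
    fix x assume x: "x \<in> (\<Inter>k. ball z (exp (- real k)))"
    have "(\<lambda>k. exp (- real k)) \<longlonglongrightarrow> 0" by real_asymp
    then have "dist z x \<le> 0"
      by (rule LIMSEQ_le_const) (use x in \<open>auto intro: less_imp_le\<close>)
    then show "x \<in> {z}" by simp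
  qed auto
  moreover have "decseq (\<lambda>k. ball z (exp (- real k)))"
    unfolding decseq_def by (intro allI impI subset_ball) simp
  then have "(\<lambda>k. measure \<mu> (ball z (exp (- real k)))) \<longlonglongrightarrow>
      measure \<mu> (\<Inter>k. ball z (exp (- real k)))"
    using assms(2) by (intro finite_Lim_measure_decseq) auto
  ultimately show ?thesis by simp
qed

text \<open>The centre is fixed here: \<open>late\<close> records what almost every centre
  satisfies, and \<open>r\<close> and \<open>c\<close> are arbitrary afterwards.\<close>

lemma hitting_set_null:
  fixes \<mu> :: "'a::metric_space measure"
  assumes ps: "prob_space \<mu>" and sp: "space \<mu> = UNIV" and bor: "sets borel \<subseteq> sets \<mu>"
    and erg: "ergodic \<mu> f"
    and late: "\<And>t. t \<ge> 0 \<Longrightarrow> \<forall>\<^sub>F k in sequentially.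
           0 < measure \<mu> (ball z (exp (- real k))) \<and>
           exp (- t) / 2 \<le> measure \<mu> (late_hit \<mu> f z (exp (- real k)) t)"
    and c: "c > 0" and r: "\<And>n. n \<ge> 1 \<Longrightarrow> measure \<mu> (ball z (r n)) \<le> c / real n"
  shows "measure \<mu> (eventually_always_hitting f z r) = 0"
proof -
  interpret prob_space \<mu> by fact
  have mp: "measure_preserving \<mu> f" using erg by (simp add: ergodic_def)
  define b where "b k = measure \<mu> (ball z (exp (- real k)))" for k
  have b_lim: "b \<longlonglongrightarrow> measure \<mu> {z}"
    using ball_measure_tendsto[OF ps bor, of z] by (simp add: b_def[abs_def])
  have bs: "ball y \<rho> \<in> sets \<mu>" for y \<rho> using bor by auto
  have hs: "hit_by f z r n \<in> sets \<mu>" for n by (rule hit_by_sets[OF mp sp bor])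
  define H where "H = {x. \<forall>\<^sub>F m in sequentially. x \<in> hit_by f z r m}"
  have H: "H \<in> sets \<mu>" unfolding H_def by (intro sets_eventually_mem sp hs)
  have zs: "{z} \<in> sets \<mu>" using bor by auto
  have small: "\<forall>\<^sub>F n in sequentially. n \<ge> 1 \<and> measure \<mu> (ball z (r n)) < a" if "a > 0" for a
  proof -
    have "(\<lambda>n. c / real n) \<longlonglongrightarrow> 0" by real_asymp
    then have "\<forall>\<^sub>F n in sequentially. c / real n < a" using that by (rule order_tendstoD)
    then show ?thesis using eventually_ge_at_top[of 1]
      by eventually_elim (use r in fastforce)
  qed
  have "measure \<mu> H = 0"
  proof (cases "measure \<mu> {z} = 0")
    case False
    then have pos: "measure \<mu> {z} > 0" by (simp add: zero_less_measure_iff)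
    have "\<forall>\<^sub>F n in sequentially. hit_by f z r n = {}"
      using small[OF pos]
    proof eventually_elim
      case (elim n)
      \<comment> \<open>A ball containing \<open>z\<close> weighs at least as much as the atom. A
        ball missing its own centre has nonpositive radius, so it is empty.\<close>
      have "z \<notin> ball z (r n)"
        using finite_measure_mono[of "{z}" "ball z (r n)"] elim bs by force
      then have "ball z (r n) = {}" by simp
      then show ?case unfolding hit_by_def by blast
    qed
    then have "\<forall>\<^sub>F n in sequentially. False" if "x \<in> H" for x
      using that unfolding H_def mem_Collect_eq by eventually_elim blast
    then have "H = {}" by auto
    then show ?thesis by simp
  next
    case True
    \<comment> \<open>Small measure forces small radius: some ball of radius below \<open>d\<close>
      has positive measure \<open>b k\<close> (from \<open>late\<close> at \<open>t = 0\<close>),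
      and \<open>ball z (r n)\<close> eventually weighs less.\<close>
    have r_small: "\<forall>\<^sub>F n in sequentially. r n < d" if "d > 0" for d
    proof -
      have "(\<lambda>k. exp (- real k)) \<longlonglongrightarrow> 0" by real_asymp
      then have "\<forall>\<^sub>F k in sequentially. exp (- real k) < d"
        using that by (rule order_tendstoD)
      moreover have "\<forall>\<^sub>F k in sequentially. 0 < b k"
        using late[of 0] unfolding b_def by (simp add: eventually_conj_iff)
      ultimately have "\<forall>\<^sub>F k in sequentially. exp (- real k) < d \<and> 0 < b k"
        by (rule eventually_conj)
      then obtain k where k: "exp (- real k) < d" "0 < b k"
        by (auto simp: eventually_sequentially)
      from small[OF k(2)] show ?thesis
      proof eventually_elim
        case (elim n)
        show ?case
        proof (rule ccontr)
          assume "\<not> r n < d"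
          then have "b k \<le> measure \<mu> (ball z (r n))"
            unfolding b_def using k(1) bs by (intro finite_measure_mono subset_ball) auto
          with elim show False by simp
        qed
      qed
    qed
    \<comment> \<open>For \<open>x \<noteq> z\<close> a hit at time 0 is impossible once
      \<open>r n < dist z x\<close>. The hit then occurs at some time \<open>Suc j\<close>, and
      \<open>f x\<close> hits the same ball at time \<open>j\<close>.\<close>
    have "H - f -` H \<subseteq> {z}"
    proof (rule subsetI, rule ccontr)
      fix x assume "x \<in> H - f -` H" "x \<notin> {z}"
      then have x: "x \<in> H" "f x \<notin> H" "x \<noteq> z" by auto
      then have "\<forall>\<^sub>F n in sequentially. x \<in> hit_by f z r n" "dist z x > 0"
        by (auto simp: H_def)
      with r_small[of "dist z x"] have "\<forall>\<^sub>F n in sequentially. r n < dist z x"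
        "\<forall>\<^sub>F n in sequentially. x \<in> hit_by f z r n"
        by blast+
      then have "\<forall>\<^sub>F n in sequentially. f x \<in> hit_by f z r n"
      proof eventually_elim
        case (elim n)
        then obtain k where k: "k \<le> n - 1" "(f ^^ k) x \<in> ball z (r n)"
          by (auto simp: hit_by_def)
        with elim obtain j where "k = Suc j" by (cases k) auto
        with k have "j \<le> n - 1" "(f ^^ j) (f x) \<in> ball z (r n)"
          by (auto simp: funpow_swap1)
        then show ?case by (auto simp: hit_by_def)
      qed
      then show False using x(2) by (simp add: H_def)
    qed
    then have inv: "measure \<mu> (H - f -` H) = 0"
      using finite_measure_mono[of "H - f -` H" "{z}"] zs True measure_nonneg
      by (metis order_antisym)
    \<comment> \<open>The lower bound of \<open>late\<close> at \<open>t = c + 1\<close>.\<close>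
    define \<delta> where "\<delta> = exp (- (c + 1)) / 2"
    have "\<exists>\<^sub>F n in sequentially. prob (hit_by f z r n) \<le> 1 - \<delta>"
      unfolding frequently_sequentially
    proof
      \<comment> \<open>As \<open>z\<close> is no atom, \<open>b\<close> tends to 0; taking
        \<open>b k\<close> below \<open>c / (N + 1)\<close> makes the time \<open>n\<close> chosen
        below at least \<open>N\<close>.\<close>
      fix N :: nat
      have "\<forall>\<^sub>F k in sequentially. b k < c / real (N + 1)"
        using b_lim c True by (intro order_tendstoD) auto
      with late[of "c + 1"] c
      have "\<forall>\<^sub>F k in sequentially. b k < c / real (N + 1) \<and> 0 < b k \<and>
              \<delta> \<le> prob (late_hit \<mu> f z (exp (- real k)) (c + 1))"
        by (simp add: b_def \<delta>_def eventually_conj_iff)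
      then obtain k where k: "b k < c / real (N + 1)" "0 < b k"
          "\<delta> \<le> prob (late_hit \<mu> f z (exp (- real k)) (c + 1))"
        by (auto simp: eventually_sequentially)
      \<comment> \<open>The least integer above \<open>c / b k\<close>, so that
        \<open>c / n < b k\<close>: the ball at time \<open>n\<close> weighs less than the reference
        ball and is therefore smaller.\<close>
      define n where "n = nat \<lfloor>c / b k\<rfloor> + 1"
      have n1: "n \<ge> 1" by (simp add: n_def)
      have pos: "c / b k > 0" using c k by simp
      have n: "c / b k < real n"
        unfolding n_def using pos by (simp add: of_nat_nat) linarith
      have "real N < c / b k"
        using k(1,2) by (simp add: field_simps)
      then have "n \<ge> N" using n by linarith
      have "c / real n < b k"
        using n k(2) n1 by (simp add: field_simps)
      then have lt: "measure \<mu> (ball z (r n)) < b k"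
        using r[OF n1] by simp
      have rn: "r n < exp (- real k)"
      proof (rule ccontr)
        assume "\<not> ?thesis"
        then have "b k \<le> measure \<mu> (ball z (r n))"
          unfolding b_def using bs by (intro finite_measure_mono subset_ball) auto
        with lt show False by simp
      qed
      \<comment> \<open>The last time tested by \<open>hit_by\<close> is \<open>n - 1\<close>, which
        equals the integer part of \<open>c / b k\<close>.\<close>
      have win: "n - 1 \<le> nat \<lfloor>(c + 1) / b k\<rfloor>"
        unfolding n_def using k(2) by (auto intro!: nat_mono floor_mono divide_right_mono)
      have "(f ^^ j) x \<notin> ball z (r n)"
        if "x \<in> late_hit \<mu> f z (exp (- real k)) (c + 1)" "j \<le> n - 1" for x j
      proof -
        have "j \<le> nat \<lfloor>(c + 1) / b k\<rfloor>" using that(2) win by (rule order_trans)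
        then have "(f ^^ j) x \<notin> ball z (exp (- real k))"
          using that(1) by (simp add: late_hit_def b_def)
        then show ?thesis using rn by simp
      qed
      then have "late_hit \<mu> f z (exp (- real k)) (c + 1) \<subseteq> space \<mu> - hit_by f z r n"
        unfolding hit_by_def sp by fastforce
      then have "\<delta> \<le> prob (space \<mu> - hit_by f z r n)"
        using k(3) hs by (meson finite_measure_mono order_trans sets.compl_sets)
      then have "prob (hit_by f z r n) \<le> 1 - \<delta>"
        using hs by (simp add: prob_compl)
      with \<open>n \<ge> N\<close> show "\<exists>n\<ge>N. prob (hit_by f z r n) \<le> 1 - \<delta>" by blast
    qed
    then have "measure \<mu> H \<le> 1 - \<delta>"
      unfolding H_def by (intro measure_eventually_mem_le sp hs)
    moreover have "\<delta> > 0" by (simp add: \<delta>_def)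
    ultimately have "measure \<mu> H < 1" by simp
    then show ?thesis
      using ergodic_forward_invariant_null[OF ps sp erg H _ inv] by blast
  qed
  then show ?thesis by (simp add: H_def eventually_always_hitting_eq)
qed

section \<open>Exceedances of the running maximum\<close>

lemma running_max_exceeds_iff:
  assumes "n \<ge> 1"
  shows "running_max f (observable \<psi> z) n x > u \<longleftrightarrow> (\<exists>k\<in>{0..n - 1}. \<psi> (dist ((f ^^ k) x) z) > u)"
proof -
  have "running_max f (observable \<psi> z) n x > u \<longleftrightarrow> (\<exists>i\<in>{1..n}. \<psi> (dist ((f ^^ (i - 1)) x) z) > u)"
    unfolding running_max_def using assms
    by (subst Max_gr_iff) (auto simp: process_def observable_def)
  also have "\<dots> \<longleftrightarrow> (\<exists>k\<in>{0..n - 1}. \<psi> (dist ((f ^^ k) x) z) > u)"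
  proof
    assume "\<exists>k\<in>{0..n - 1}. \<psi> (dist ((f ^^ k) x) z) > u"
    then obtain k where "k \<le> n - 1" "\<psi> (dist ((f ^^ k) x) z) > u" by auto
    \<comment> \<open>\<open>process\<close> at index \<open>i\<close> applies \<open>i - 1\<close>
      iterates, so time \<open>k\<close> corresponds to index \<open>Suc k\<close>.\<close>
    then show "\<exists>i\<in>{1..n}. \<psi> (dist ((f ^^ (i - 1)) x) z) > u"
      using assms by (intro bexI[of _ "Suc k"]) auto
  next
    assume "\<exists>i\<in>{1..n}. \<psi> (dist ((f ^^ (i - 1)) x) z) > u"
    then obtain i where "i \<in> {1..n}" "\<psi> (dist ((f ^^ (i - 1)) x) z) > u" by blast
    then show "\<exists>k\<in>{0..n - 1}. \<psi> (dist ((f ^^ k) x) z) > u"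
      by (intro bexI[of _ "i - 1"]) auto
  qed
  finally show ?thesis .
qed

text \<open>Continuity of \<open>\<psi>\<close> makes the exceedance set of a single observation
  open; its preimages under the iterates are measurable.\<close>

lemma running_max_exceeds_sets:
  assumes mp: "measure_preserving \<mu> f" and sp: "space \<mu> = UNIV" and bor: "sets borel \<subseteq> sets \<mu>"
    and cont: "continuous_on {0..} \<psi>"
  shows "{x. running_max f (observable \<psi> z) n x > u} \<in> sets \<mu>"
proof (cases "n \<ge> 1")
  case True
  have "open {y. \<psi> (dist y z) > u}"
    by (intro open_Collect_less continuous_on_compose2[OF cont] continuous_intros) auto
  then have "{y. \<psi> (dist y z) > u} \<in> sets \<mu>" using bor by auto
  then have "(\<Union>k\<in>{0..n - 1}. (f ^^ k) -` {y. \<psi> (dist y z) > u}) \<in> sets \<mu>"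
    by (intro sets.finite_UN vimage_funpow_sets[OF mp sp]) auto
  also have "(\<Union>k\<in>{0..n - 1}. (f ^^ k) -` {y. \<psi> (dist y z) > u}) =
      {x. running_max f (observable \<psi> z) n x > u}"
    by (auto simp: running_max_exceeds_iff[OF True])
  finally show ?thesis .
next
  case False
  \<comment> \<open>At \<open>n = 0\<close> the maximum is the constant \<open>Max {}\<close>, so
    the set is empty or the whole space.\<close>
  then show ?thesis
    using sp sets.top[of \<mu>] by (cases "Max {} > u") (auto simp: running_max_def)
qed

text \<open>(A5) controls only centres outside exceptional sets, so the result is for almost every
  centre. The null set is fixed before \<open>r\<close> and \<open>c\<close> are chosen.\<close>

theorem theorem5p2:
  fixes \<mu> :: "'a::metric_space measure"
    and f :: "'a \<Rightarrow> 'a"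
    and \<psi> :: "real \<Rightarrow> ereal"
    and \<sigma>1 \<sigma>2 :: real
  assumes "prob_space \<mu>"
    and "space \<mu> = UNIV"
    and "sets borel \<subseteq> sets \<mu>"
    and "ergodic \<mu> f"
    and "\<sigma>1 > 1" and "\<sigma>2 > 1"
    and "assumption_A5 \<mu> f \<sigma>1 \<sigma>2"
    and "antimono_on {0..} \<psi>"
    and "continuous_on {0..} \<psi>"
    and "(\<psi> \<longlongrightarrow> \<infinity>) (at_right 0)"
  shows "AE z in \<mu>. \<forall>(r :: nat \<Rightarrow> real) (c :: real).
           c > 0 \<longrightarrow>
           (\<forall>n\<ge>1. r n \<ge> 0 \<and> measure \<mu> (ball z (r n)) \<le> c / real n) \<longrightarrow>
           measure \<mu> {x. \<exists>\<^sub>F n in sequentially.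
               running_max f (observable \<psi> z) n x \<le> \<psi> (r n)} = 1 \<and>
           measure \<mu> (eventually_always_hitting f z r) = 0 \<and>
           measure \<mu> {x. \<forall>\<^sub>F n in sequentially.
               running_max f (observable \<psi> z) n x > \<psi> (r n)} = 0"
proof -
  interpret prob_space \<mu> by fact
  have mp: "measure_preserving \<mu> f" using \<open>ergodic \<mu> f\<close> by (simp add: ergodic_def)
  show ?thesis
    using A5_AE_late_hit[OF assms(1,2,5,6,7)]
  proof (rule AE_mp, intro AE_I2 impI allI)
    fix z and r :: "nat \<Rightarrow> real" and c :: real
    assume late: "\<forall>t\<ge>0. \<forall>\<^sub>F k in sequentially.
           0 < measure \<mu> (ball z (exp (- real k))) \<and>
           exp (- t) / 2 \<le> measure \<mu> (late_hit \<mu> f z (exp (- real k)) t)"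
      and c: "c > 0"
      and r: "\<forall>n\<ge>1. r n \<ge> 0 \<and> measure \<mu> (ball z (r n)) \<le> c / real n"
    have H0: "measure \<mu> (eventually_always_hitting f z r) = 0"
      by (rule hitting_set_null[OF assms(1-4) _ c]) (use late r in auto)
    have H: "eventually_always_hitting f z r \<in> sets \<mu>"
      unfolding eventually_always_hitting_eq
      by (intro sets_eventually_mem hit_by_sets mp assms)
    define S where "S = {x. \<forall>\<^sub>F n in sequentially.
               running_max f (observable \<psi> z) n x > \<psi> (r n)}"
    have S: "S \<in> sets \<mu>"
      using sets_eventually_mem[of "\<lambda>n. {x. running_max f (observable \<psi> z) n x > \<psi> (r n)}"]
        running_max_exceeds_sets[OF mp assms(2,3,9)] assms(2)
      by (simp add: S_def)
    \<comment> \<open>As \<open>\<psi>\<close> is decreasing, a value strictly above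
      \<open>\<psi> (r n)\<close> forces distance below \<open>r n\<close>. The converse may fail
      where \<open>\<psi>\<close> is constant, so only an inclusion is claimed.\<close>
    have "S \<subseteq> eventually_always_hitting f z r"
    proof
      fix x assume "x \<in> S"
      then have "\<forall>\<^sub>F n in sequentially. running_max f (observable \<psi> z) n x > \<psi> (r n)"
        by (simp add: S_def)
      then have "\<forall>\<^sub>F n in sequentially. x \<in> hit_by f z r n"
        using eventually_ge_at_top[of 1]
      proof eventually_elim
        case (elim n)
        then obtain k where k: "k \<in> {0..n - 1}" "\<psi> (dist ((f ^^ k) x) z) > \<psi> (r n)"
          by (auto simp: running_max_exceeds_iff)
        have "dist ((f ^^ k) x) z < r n"
        proof (rule ccontr)
          assume "\<not> ?thesis"
          then have "\<psi> (dist ((f ^^ k) x) z) \<le> \<psi> (r n)"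
            using r elim by (intro monotone_onD[OF assms(8)]) auto
          with k show False by simp
        qed
        with k show ?case by (auto simp: hit_by_def dist_commute)
      qed
      then show "x \<in> eventually_always_hitting f z r" by (simp add: eventually_always_hitting_eq)
    qed
    then have S0: "measure \<mu> S = 0"
      using finite_measure_mono[OF _ H] H0 measure_nonneg by (metis order_antisym)
    have "{x. \<exists>\<^sub>F n in sequentially. running_max f (observable \<psi> z) n x \<le> \<psi> (r n)} = space \<mu> - S"
      using assms(2) by (auto simp: S_def frequently_def not_le)
    then have "measure \<mu> {x. \<exists>\<^sub>F n in sequentially.
               running_max f (observable \<psi> z) n x \<le> \<psi> (r n)} = 1"
      using prob_compl[OF S] S0 by simp
    with H0 S0 show "measure \<mu> {x. \<exists>\<^sub>F n in sequentially.
               running_max f (observable \<psi> z) n x \<le> \<psi> (r n)} = 1 \<and>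
           measure \<mu> (eventually_always_hitting f z r) = 0 \<and>
           measure \<mu> {x. \<forall>\<^sub>F n in sequentially.
               running_max f (observable \<psi> z) n x > \<psi> (r n)} = 0"
      by (simp add: S_def)
  qed
qed

end
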